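(* Let $f:\mathbb{R}\to\mathbb{C}$ be a piecewise smooth function and let $U\subseteq\mathbb{R}^2$ be such that, for every $(x_1,x_2)\in U$, the function $$g(t)=e^{(-x_1H(t)+x_2H(-t))t}f(t)$$ is absolutely integrable on $\mathbb{R}$. Let $F(x_1,x_2,y)$ be the symmetric Laplace transform of $f$, i.e. $$F(x_1,x_2,y)=\int_{-\infty}^{\infty}e^{(-x_1H(t)+x_2H(-t)-iy)t}f(t)\,dt,\qquad (x_1,x_2)\in U,\ y\in\mathbb{R}.$$ Then for every $(x_1,x_2)\in U$ and every $t\in\mathbb{R}$, $$\lim_{A\to\infty}\frac{1}{2\pi}\int_{-A}^{A}F(x_1,x_2,y)\,e^{(x_1H(t)-x_2H(-t)+iy)t}\,dy=\frac12\bigl(f(t+)+f(t-)\bigr).$$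
   Context: $H:\mathbb{R}\to\mathbb{R}$ is the Heaviside function: $H(t)=1$ for $t\ge 0$ and $H(t)=0$ for $t<0$. A function $g:\mathbb{R}\to\mathbb{C}$ is absolutely integrable on $\mathbb{R}$ if $\int_{-\infty}^{\infty}|g(t)|\,dt<\infty$. Piecewise smooth has its usual meaning: on every bounded interval, $f$ and $f'$ are continuous except at finitely many points, and at every point the one-sided limits of $f$ and of $f'$ exist and are finite. $f(t+)$ and $f(t-)$ denote the right and left limits of $f$ at $t$. *)

theory Defs
  imports "HOL-Probability.Probability"
begin

definition heaviside :: "real \<Rightarrow> real" where
  "heaviside t = (if t \<ge> 0 then 1 else 0)"

text \<open>
  On each bounded interval the derivative may be undefined or discontinuous on a finite
  exceptional set.  Since \<^const>\<open>vector_derivative\<close> is total, differentiability off that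
  set is required explicitly.  The derivative thus exists in a punctured neighbourhood of every
  point, so its one-sided limits do not depend on arbitrary values.
\<close>

definition piecewise_smooth :: "(real \<Rightarrow> complex) \<Rightarrow> bool" where
  "piecewise_smooth f \<longleftrightarrow>
     (\<forall>a b. \<exists>S. finite S \<and>
        (\<forall>t\<in>{a..b} - S. isCont f t \<and> f differentiable (at t) \<and>
           isCont (\<lambda>s. vector_derivative f (at s)) t)) \<and>
     (\<forall>t. (\<exists>l. (f \<longlongrightarrow> l) (at_left t)) \<and>
          (\<exists>l. (f \<longlongrightarrow> l) (at_right t)) \<and>
          (\<exists>l. ((\<lambda>s. vector_derivative f (at s)) \<longlongrightarrow> l) (at_left t)) \<and>
          (\<exists>l. ((\<lambda>s. vector_derivative f (at s)) \<longlongrightarrow> l) (at_right t)))"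

definition symmetric_laplace :: "(real \<Rightarrow> complex) \<Rightarrow> real \<Rightarrow> real \<Rightarrow> real \<Rightarrow> complex" where
  "symmetric_laplace f x1 x2 y =
     (LINT t|lborel. exp ((complex_of_real (- x1 * heaviside t + x2 * heaviside (- t))
                            - \<i> * complex_of_real y) * complex_of_real t) * f t)"

end

theory Submission
  imports Defs
begin

text \<open>
  After multiplication by the weight, which is positive, continuous and locally Lipschitz, the claim
  is pointwise Fourier inversion for the integrable weighted function \<open>g\<close>.  By Fubini the truncated integral
  is \<open>\<integral> g(t + u) \<cdot> 2 sin(A u)/u du\<close>.  Subtracting the constants \<open>g(t\<plusminus>)\<close> near 0 leaves \<open>sin(A u)\<close>
  times an integrable function, which tends to 0 by the Riemann-Lebesgue lemma; the constants
  contribute multiples of the sine integral \<open>Si(A d) \<rightarrow> \<pi>/2\<close>.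
\<close>

section \<open>The Riemann-Lebesgue lemma for the sine transform\<close>

text \<open>The property is named because it survives sums, scaling and dominated limits, so it can
  be proved by induction over Borel sets and over integrable functions. Integrability stays outside
  the predicate and travels as a separate hypothesis.\<close>

definition sin_transform_vanishes :: "(real \<Rightarrow> 'a::{banach, second_countable_topology}) \<Rightarrow> bool" where
  "sin_transform_vanishes f \<longleftrightarrow> ((\<lambda>y. LINT t|lborel. sin (y * t) *\<^sub>R f t) \<longlongrightarrow> 0) at_top"

lemma integrable_sin_scaleR:
  fixes f :: "real \<Rightarrow> 'a::{banach, second_countable_topology}"
  assumes "integrable lborel f"
  shows "integrable lborel (\<lambda>t. sin (y * t) *\<^sub>R f t)"
proof (rule Bochner_Integration.integrable_bound[OF assms])
  show "(\<lambda>t. sin (y * t) *\<^sub>R f t) \<in> borel_measurable lborel"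
    using borel_measurable_integrable[OF assms] by measurable
  show "AE t in lborel. norm (sin (y * t) *\<^sub>R f t) \<le> norm (f t)"
    by (auto intro!: mult_left_le_one_le)
qed

lemma sin_transform_vanishes_add:
  assumes "integrable lborel f" "integrable lborel g" "sin_transform_vanishes f" "sin_transform_vanishes g"
  shows "sin_transform_vanishes (\<lambda>t. f t + g t)"
  using tendsto_add[OF assms(3,4)[unfolded sin_transform_vanishes_def]]
  by (simp add: sin_transform_vanishes_def scaleR_add_right integrable_sin_scaleR assms)

lemma sin_transform_vanishes_diff:
  assumes "integrable lborel f" "integrable lborel g" "sin_transform_vanishes f" "sin_transform_vanishes g"
  shows "sin_transform_vanishes (\<lambda>t. f t - g t)"
  using tendsto_diff[OF assms(3,4)[unfolded sin_transform_vanishes_def]]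
  by (simp add: sin_transform_vanishes_def scaleR_diff_right integrable_sin_scaleR assms)

lemma sin_transform_vanishes_sum:
  assumes "finite I" "\<And>i. i \<in> I \<Longrightarrow> integrable lborel (f i)" "\<And>i. i \<in> I \<Longrightarrow> sin_transform_vanishes (f i)"
  shows "sin_transform_vanishes (\<lambda>t. \<Sum>i\<in>I. f i t)"
  using assms
  by (induction rule: finite_induct) (auto intro!: sin_transform_vanishes_add simp: sin_transform_vanishes_def[of "\<lambda>_. 0"])

lemma sin_transform_vanishes_scaleR_left:
  assumes "integrable lborel f" "sin_transform_vanishes (f :: real \<Rightarrow> real)"
  shows "sin_transform_vanishes (\<lambda>t. f t *\<^sub>R c)"
proof -
  have "((\<lambda>y. (LINT t|lborel. sin (y * t) *\<^sub>R f t) *\<^sub>R c) \<longlongrightarrow> 0 *\<^sub>R c) at_top"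
    using assms(2) unfolding sin_transform_vanishes_def by (intro tendsto_intros)
  moreover have "(LINT t|lborel. sin (y * t) *\<^sub>R (f t *\<^sub>R c)) = (LINT t|lborel. sin (y * t) *\<^sub>R f t) *\<^sub>R c" for y
    using integral_scaleR_left[of c lborel "\<lambda>t. sin (y * t) * f t"] integrable_sin_scaleR[OF assms(1), of y]
    by simp
  ultimately show ?thesis by (simp add: sin_transform_vanishes_def)
qed

text \<open>Since the kernel is bounded by 1, the transforms of \<open>s i\<close> and
  \<open>f\<close> differ by at most the L1 norm of \<open>s i - f\<close>, uniformly in the
  frequency. Dominated convergence makes this norm small, so one fixed \<open>i\<close> carries the
  decay over to \<open>f\<close>.\<close>

lemma sin_transform_vanishes_limit:
  fixes f :: "real \<Rightarrow> 'a::{banach, second_countable_topology}" and w :: "real \<Rightarrow> real"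
  assumes s: "\<And>i. integrable lborel (s i)" "\<And>i. sin_transform_vanishes (s i)"
    and f: "integrable lborel f" and w: "integrable lborel w"
    and lim: "\<And>x. (\<lambda>i. s i x) \<longlonglongrightarrow> f x"
    and bound: "\<And>i x. norm (s i x - f x) \<le> w x"
  shows "sin_transform_vanishes f"
  unfolding sin_transform_vanishes_def tendsto_iff
proof (intro allI impI)
  fix e :: real assume e: "0 < e"
  have [measurable]: "s i \<in> borel_measurable lborel" "f \<in> borel_measurable lborel" for i
    using s(1) f by auto
  have "(\<lambda>i. LINT x|lborel. norm (s i x - f x)) \<longlonglongrightarrow> (LINT x::real|lborel. (0::real))"
  proof (rule integral_dominated_convergence[where w = w])
    show "AE x in lborel. (\<lambda>i. norm (s i x - f x)) \<longlonglongrightarrow> 0"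
      using tendsto_norm_zero[OF LIM_zero[OF lim]] by auto
  qed (use bound w in auto)
  then have "\<forall>\<^sub>F i in sequentially. (LINT x|lborel. norm (s i x - f x)) < e / 2"
    using e by (intro order_tendstoD(2)[where y = 0]) simp_all
  then obtain i where i: "(LINT x|lborel. norm (s i x - f x)) < e / 2"
    by (auto dest: eventually_happens)
  have "\<forall>\<^sub>F y in at_top. norm (LINT t|lborel. sin (y * t) *\<^sub>R s i t) < e / 2"
    using order_tendstoD(2)[OF tendsto_norm_zero[OF s(2)[of i, unfolded sin_transform_vanishes_def]], of "e / 2"] e
    by simp
  then show "\<forall>\<^sub>F y in at_top. dist (LINT t|lborel. sin (y * t) *\<^sub>R f t) 0 < e"
  proof eventually_elim
    case (elim y)
    have "(LINT t|lborel. sin (y * t) *\<^sub>R s i t) - (LINT t|lborel. sin (y * t) *\<^sub>R f t)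
        = (LINT t|lborel. sin (y * t) *\<^sub>R (s i t - f t))"
      by (simp add: scaleR_diff_right integrable_sin_scaleR s f)
    also have "norm \<dots> \<le> (LINT t|lborel. norm (sin (y * t) *\<^sub>R (s i t - f t)))"
      by (rule integral_norm_bound)
    also have "\<dots> \<le> (LINT t|lborel. norm (s i t - f t))"
      by (intro integral_mono integrable_norm integrable_sin_scaleR Bochner_Integration.integrable_diff s f)
        (auto intro!: mult_left_le_one_le)
    finally show ?case
      using i elim norm_triangle_ineq2[of "LINT t|lborel. sin (y * t) *\<^sub>R f t" "LINT t|lborel. sin (y * t) *\<^sub>R s i t"]
      by (simp add: norm_minus_commute dist_norm)
  qed
qed

text \<open>The explicit antiderivative of \<open>sin (y * t)\<close> bounds the transform by
  \<open>2 / y\<close>.\<close>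

lemma sin_transform_vanishes_indicator_Icc: "sin_transform_vanishes (indicator {a..b} :: real \<Rightarrow> real)"
proof (cases "a \<le> b")
  case True
  have eq: "(LINT t|lborel. sin (y * t) *\<^sub>R (indicator {a..b} t :: real)) = (cos (y * a) - cos (y * b)) / y"
    if "y > 0" for y
  proof -
    have "(LBINT t=a..b. sin (y * t)) = - cos (y * b) / y - (- cos (y * a) / y)"
    proof (rule interval_integral_FTC_finite)
      show "continuous_on {min a b..max a b} (\<lambda>t. sin (y * t))"
        by (intro continuous_intros)
      show "((\<lambda>t. - cos (y * t) / y) has_vector_derivative sin (y * x)) (at x within {min a b..max a b})" for x
        unfolding has_real_derivative_iff_has_vector_derivative[symmetric]
        using that by (auto intro!: derivative_eq_intros)
    qed
    then show ?thesis
      using interval_integral_Icc[OF True, of "\<lambda>t. sin (y * t)"] that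
      by (simp add: set_lebesgue_integral_def diff_divide_distrib mult.commute)
  qed
  have "((\<lambda>y. (cos (y * a) - cos (y * b)) / y) \<longlongrightarrow> 0) at_top"
  proof (rule Lim_null_comparison)
    show "\<forall>\<^sub>F y in at_top. norm ((cos (y * a) - cos (y * b)) / y) \<le> 2 / y"
      using eventually_gt_at_top[of 0]
    proof eventually_elim
      case (elim y)
      have "\<bar>cos (y * a) - cos (y * b)\<bar> \<le> 1 + 1"
        using abs_cos_le_one[of "y * a"] abs_cos_le_one[of "y * b"] by linarith
      then show ?case using elim by (simp add: divide_right_mono)
    qed
    show "((\<lambda>y. 2 / y :: real) \<longlongrightarrow> 0) at_top"
      by (intro tendsto_divide_0[OF tendsto_const] filterlim_at_top_imp_at_infinity filterlim_ident)
  qed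
  then show ?thesis
    unfolding sin_transform_vanishes_def
  proof (rule Lim_transform_eventually)
    show "\<forall>\<^sub>F y in at_top. (cos (y * a) - cos (y * b)) / y
        = (LINT t|lborel. sin (y * t) *\<^sub>R (indicator {a..b} t :: real))"
      using eventually_gt_at_top[of 0] by eventually_elim (simp only: eq)
  qed
qed (simp add: sin_transform_vanishes_def)

lemma integrable_indicator_Int_Icc:
  assumes "A \<in> sets borel"
  shows "integrable lborel (indicator (A \<inter> {a..b}) :: real \<Rightarrow> real)"
proof (rule integrable_real_indicator)
  have "emeasure lborel (A \<inter> {a..b}) \<le> emeasure lborel {a..b}"
    by (intro emeasure_mono) auto
  then show "emeasure lborel (A \<inter> {a..b}) < \<infinity>"
    by (rule order.strict_trans1) (simp add: emeasure_lborel_Icc_eq)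
qed (use assms in simp)

text \<open>Induction over Borel sets passes through complements, which may have infinite measure.
  Intersecting with a fixed compact interval keeps every indicator integrable and turns a complement
  into a difference of indicators.\<close>

lemma sin_transform_vanishes_indicator_Int_Icc:
  assumes "A \<in> sets borel"
  shows "sin_transform_vanishes (indicator (A \<inter> {a..b}) :: real \<Rightarrow> real)"
  using assms
proof (induction A rule: borel_set_induct)
  case empty
  show ?case by (simp add: sin_transform_vanishes_def)
next
  case (interval c d)
  have "{c..d} \<inter> {a..b} = {max c a..min d b}" by auto
  then show ?case by (simp add: sin_transform_vanishes_indicator_Icc)
next
  case (compl A)
  have "sin_transform_vanishes (\<lambda>t. indicator {a..b} t - indicator (A \<inter> {a..b}) t :: real)"
    using compl integrable_indicator_Int_Icc[of UNIV a b]
    by (intro sin_transform_vanishes_diff sin_transform_vanishes_indicator_Icc integrable_indicator_Int_Icc) auto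
  moreover have "(\<lambda>t. indicator {a..b} t - indicator (A \<inter> {a..b}) t :: real) = indicator (- A \<inter> {a..b})"
    by (auto simp: indicator_def)
  ultimately show ?case by simp
next
  case (union A)
  \<comment> \<open>The finite unions \<open>?B n\<close> are disjoint, so their indicators are
    finite sums. They increase to the full union, and the differences are dominated by the indicator
    of \<open>{a..b}\<close>.\<close>
  let ?B = "\<lambda>n. (\<Union>i<n. A i)"
  show ?case
  proof (rule sin_transform_vanishes_limit[where w = "indicator {a..b}" and s = "\<lambda>n. indicator (?B n \<inter> {a..b})"])
    fix n
    have "sin_transform_vanishes (\<lambda>t. \<Sum>i<n. indicator (A i \<inter> {a..b}) t :: real)"
      using union by (intro sin_transform_vanishes_sum integrable_indicator_Int_Icc) auto
    moreover have "(\<Sum>i<n. indicator (A i \<inter> {a..b}) t :: real) = indicator (?B n \<inter> {a..b}) t" for t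
      using disjoint_family_on_mono[OF subset_UNIV union(1), of "{..<n}"]
      by (simp add: indicator_UN_disjoint indicator_inter_arith sum_distrib_right)
    ultimately show "sin_transform_vanishes (indicator (?B n \<inter> {a..b}) :: real \<Rightarrow> real)"
      by simp
    show "integrable lborel (indicator (?B n \<inter> {a..b}) :: real \<Rightarrow> real)"
      using union by (intro integrable_indicator_Int_Icc) auto
  next
    show "integrable lborel (indicator ((\<Union>i. A i) \<inter> {a..b}) :: real \<Rightarrow> real)"
      using union by (intro integrable_indicator_Int_Icc) auto
    show "integrable lborel (indicator {a..b} :: real \<Rightarrow> real)"
      using integrable_indicator_Int_Icc[of UNIV a b] by simp
    show "(\<lambda>n. indicator (?B n \<inter> {a..b}) x :: real) \<longlonglongrightarrow> indicator ((\<Union>i. A i) \<inter> {a..b}) x" for x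
      using LIMSEQ_indicator_UN[where 'a = real, of A x]
      by (simp add: indicator_inter_arith tendsto_mult)
  qed (auto split: split_indicator)
qed

text \<open>The truncations of \<open>A\<close> to growing intervals converge pointwise, and the
  indicator of \<open>A\<close>, integrable by finite measure, dominates the error.\<close>

lemma sin_transform_vanishes_indicator:
  assumes A: "A \<in> sets lborel" "emeasure lborel A < \<infinity>"
  shows "sin_transform_vanishes (indicator A :: real \<Rightarrow> real)"
proof (rule sin_transform_vanishes_limit[where w = "indicator A" and s = "\<lambda>n. indicator (A \<inter> {- real n..real n})"])
  fix x
  obtain n where n: "\<bar>x\<bar> \<le> real n" using real_arch_simple by blast
  show "(\<lambda>n. indicator (A \<inter> {- real n..real n}) x :: real) \<longlonglongrightarrow> indicator A x"
  proof (rule tendsto_eventually)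
    show "\<forall>\<^sub>F n in sequentially. (indicator (A \<inter> {- real n..real n}) x :: real) = indicator A x"
      using eventually_ge_at_top[of n]
      by eventually_elim (use n in \<open>auto split: split_indicator\<close>)
  qed
qed (use A in \<open>auto intro!: integrable_indicator_Int_Icc sin_transform_vanishes_indicator_Int_Icc integrable_real_indicator split: split_indicator\<close>)

theorem Riemann_Lebesgue_sin:
  fixes f :: "real \<Rightarrow> 'a::{banach, second_countable_topology}"
  assumes "integrable lborel f"
  shows "((\<lambda>y. LINT t|lborel. sin (y * t) *\<^sub>R f t) \<longlongrightarrow> 0) at_top"
proof -
  have "sin_transform_vanishes f"
    using assms
  proof (induction rule: integrable_induct)
    case (base A c)
    then show ?case by (intro sin_transform_vanishes_scaleR_left sin_transform_vanishes_indicator integrable_real_indicator)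
  next
    case (add f g)
    then show ?case by (intro sin_transform_vanishes_add)
  next
    case (lim f s)
    show ?case
    \<comment> \<open>The induction supplies \<open>norm (s i x) \<le> 2 * norm (f x)\<close>; the
      triangle inequality makes this a factor 3 for the difference.\<close>
    proof (rule sin_transform_vanishes_limit[where s = s and w = "\<lambda>x. 3 * norm (f x)"])
      fix i x
      have "norm (s i x) \<le> 2 * norm (f x)" using lim by auto
      then show "norm (s i x - f x) \<le> 3 * norm (f x)"
        using norm_triangle_ineq4[of "s i x" "f x"] by simp
    qed (use lim in auto)
  qed
  then show ?thesis by (simp add: sin_transform_vanishes_def)
qed


section \<open>The kernel \<open>sin (A * u) / u\<close> and one-sided limits\<close>

text \<open>Scaling reduces the right half to the sine integral; the left half follows by
  reflection, the integrand being even. These are the contributions of the constants subtracted near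
  0.\<close>

lemma LBINT_sin_scale_Ioo:
  assumes "0 < A" "0 \<le> d"
  shows "(LINT u|lborel. indicator {0<..<d} u * (sin (A * u) / u)) = Si (A * d)"
    and "(LINT u|lborel. indicator {- d<..<0} u * (sin (A * u) / u)) = Si (A * d)"
    and "integrable lborel (\<lambda>u. indicator {0<..<d} u * (sin (A * u) / u))"
    and "integrable lborel (\<lambda>u. indicator {- d<..<0} u * (sin (A * u) / u))"
proof -
  let ?f = "\<lambda>u. indicator {0<..<d} u * (sin (A * u) / u)"
  have refl: "indicator {- d<..<0} u * (sin (A * u) / u) = ?f (0 + (- 1) * u)" for u
    by (auto split: split_indicator)
  show *: "integral\<^sup>L lborel ?f = Si (A * d)"
    using LBINT_I0c_sin_scale_divide[OF assms(2), of A] assms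
    by (simp add: interval_lebesgue_integral_def set_lebesgue_integral_def zero_ereal_def mult.commute)
  show "(LINT u|lborel. indicator {- d<..<0} u * (sin (A * u) / u)) = Si (A * d)"
    unfolding refl using lborel_integral_real_affine[of "- 1" ?f 0] * by simp
  show "integrable lborel ?f"
    using integrable_sinc'[of d A] assms
    by (simp add: interval_lebesgue_integrable_def set_integrable_def mult.commute)
  then show "integrable lborel (\<lambda>u. indicator {- d<..<0} u * (sin (A * u) / u))"
    unfolding refl using lborel_integrable_real_affine_iff[of "- 1" ?f 0] by simp
qed

text \<open>After subtracting the one-sided limits within distance \<open>d\<close> of 0, the
  Lipschitz bounds keep the remainder divided by \<open>u\<close> bounded near 0, while farther out
  \<open>1 / \<bar>u\<bar>\<close> is at most \<open>1 / d\<close>. The quotient is thus integrable,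
  and the Riemann-Lebesgue lemma applies to it.\<close>

lemma Dini_sin_kernel:
  fixes g :: "real \<Rightarrow> 'a::{banach, second_countable_topology}"
  assumes g: "integrable lborel g"
    and right: "\<forall>\<^sub>F s in at_right t. norm (g s - R) \<le> M * \<bar>s - t\<bar>"
    and left: "\<forall>\<^sub>F s in at_left t. norm (g s - L) \<le> N * \<bar>s - t\<bar>"
  shows "((\<lambda>A. LINT u|lborel. (sin (A * u) / u) *\<^sub>R g (t + u)) \<longlongrightarrow> (pi / 2) *\<^sub>R (R + L)) at_top"
proof -
  obtain b c where b: "t < b" "\<And>s. t < s \<Longrightarrow> s < b \<Longrightarrow> norm (g s - R) \<le> M * \<bar>s - t\<bar>"
    and c: "c < t" "\<And>s. c < s \<Longrightarrow> s < t \<Longrightarrow> norm (g s - L) \<le> N * \<bar>s - t\<bar>"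
    using right left by (auto simp: eventually_at_right_field eventually_at_left_field)
  \<comment> \<open>This radius lies inside both one-sided neighbourhoods, so both Lipschitz bounds
    hold within it; \<open>K\<close> serves both sides and is nonnegative by construction.\<close>
  define d where "d = min (b - t) (t - c)"
  define K where "K = max \<bar>M\<bar> \<bar>N\<bar>"
  have d: "0 < d" "t + d \<le> b" "c \<le> t - d"
    using b(1) c(1) by (auto simp: d_def)
  have gt: "integrable lborel (\<lambda>u. g (t + u))"
    using lborel_integrable_real_affine[OF g, of 1 t] by simp
  have [measurable]: "(\<lambda>u. g (t + u)) \<in> borel_measurable lborel"
    using gt by auto
  define D where "D u = g (t + u) - indicator {0<..<d} u *\<^sub>R R - indicator {- d<..<0} u *\<^sub>R L" for u
  have [measurable]: "D \<in> borel_measurable lborel"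
    unfolding D_def by measurable
  have k: "integrable lborel (\<lambda>u. (1 / u) *\<^sub>R D u)"
  proof (rule Bochner_Integration.integrable_bound)
    show "integrable lborel (\<lambda>u. K * indicator {- d<..<d} u + norm (g (t + u)) / d)"
      using gt d(1) by (intro Bochner_Integration.integrable_add integrable_mult_right integrable_real_indicator) auto
    show "AE u in lborel. norm ((1 / u) *\<^sub>R D u) \<le> norm (K * indicator {- d<..<d} u + norm (g (t + u)) / d)"
    proof (rule AE_I2)
      fix u
      have K: "0 \<le> K" by (simp add: K_def)
      consider "u = 0" | "0 < u" "u < d" | "u < 0" "- d < u" | "d \<le> \<bar>u\<bar>"
        by linarith
      then have "norm ((1 / u) *\<^sub>R D u) \<le> K * indicator {- d<..<d} u + norm (g (t + u)) / d"
      proof cases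
        \<comment> \<open>Division by zero yields 0, so the left side vanishes here.\<close>
        case 1
        then show ?thesis using K d by simp
      next
        case 2
        have "norm (D u) \<le> M * \<bar>u\<bar>"
          using b(2)[of "t + u"] 2 d by (simp add: D_def)
        also have "\<dots> \<le> K * \<bar>u\<bar>"
          by (intro mult_right_mono) (auto simp: K_def)
        finally have "norm ((1 / u) *\<^sub>R D u) \<le> K"
          using 2 by (simp add: divide_simps mult.commute)
        also have "\<dots> \<le> K * indicator {- d<..<d} u + norm (g (t + u)) / d"
          using 2 d by simp
        finally show ?thesis .
      next
        case 3
        have "norm (D u) \<le> N * \<bar>u\<bar>"
          using c(2)[of "t + u"] 3 d by (simp add: D_def)
        also have "\<dots> \<le> K * \<bar>u\<bar>"
          by (intro mult_right_mono) (auto simp: K_def)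
        finally have "norm ((1 / u) *\<^sub>R D u) \<le> K"
          using 3 by (simp add: divide_simps mult.commute)
        also have "\<dots> \<le> K * indicator {- d<..<d} u + norm (g (t + u)) / d"
          using 3 d by simp
        finally show ?thesis .
      next
        case 4
        then have "norm ((1 / u) *\<^sub>R D u) = norm (g (t + u)) / \<bar>u\<bar>"
          using d by (auto simp: D_def split: split_indicator)
        also have "\<dots> \<le> norm (g (t + u)) / d"
          using 4 d by (intro divide_left_mono) auto
        finally show ?thesis
          using K by (smt (verit) indicator_pos_le mult_nonneg_nonneg)
      qed
      then show "norm ((1 / u) *\<^sub>R D u) \<le> norm (K * indicator {- d<..<d} u + norm (g (t + u)) / d)"
        by simp
    qed
  qed measurable
  have split: "(LINT u|lborel. (sin (A * u) / u) *\<^sub>R g (t + u))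
      = (LINT u|lborel. sin (A * u) *\<^sub>R ((1 / u) *\<^sub>R D u)) + Si (A * d) *\<^sub>R (R + L)" if A: "0 < A" for A
  proof -
    note sinc = LBINT_sin_scale_Ioo[OF A less_imp_le[OF d(1)]]
    \<comment> \<open>The identity also holds at \<open>u = 0\<close>, where every term is 0 by the
      convention for division.\<close>
    have "(sin (A * u) / u) *\<^sub>R g (t + u) = sin (A * u) *\<^sub>R ((1 / u) *\<^sub>R D u)
        + ((indicator {0<..<d} u * (sin (A * u) / u)) *\<^sub>R R + (indicator {- d<..<0} u * (sin (A * u) / u)) *\<^sub>R L)" for u
      by (auto simp: D_def scaleR_diff_right split: split_indicator)
    moreover have "integrable lborel (\<lambda>u. sin (A * u) *\<^sub>R ((1 / u) *\<^sub>R D u))"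
      by (rule integrable_sin_scaleR[OF k])
    ultimately show ?thesis
      using sinc by (simp add: scaleR_add_right)
  qed
  \<comment> \<open>The integral vanishes in the limit by Riemann-Lebesgue;
    \<open>Si (A * d)\<close> tends to \<open>pi / 2\<close> because \<open>d\<close> is
    positive.\<close>
  have "((\<lambda>A. (LINT u|lborel. sin (A * u) *\<^sub>R ((1 / u) *\<^sub>R D u)) + Si (A * d) *\<^sub>R (R + L))
      \<longlongrightarrow> 0 + (pi / 2) *\<^sub>R (R + L)) at_top"
    using d(1) by (intro tendsto_intros Riemann_Lebesgue_sin k filterlim_compose[OF Si_at_top]
        filterlim_at_top_mult_tendsto_pos[OF tendsto_const] filterlim_ident)
  moreover have "\<forall>\<^sub>F A in at_top. (LINT u|lborel. sin (A * u) *\<^sub>R ((1 / u) *\<^sub>R D u)) + Si (A * d) *\<^sub>R (R + L)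
      = (LINT u|lborel. (sin (A * u) / u) *\<^sub>R g (t + u))"
    using eventually_gt_at_top[of 0] by eventually_elim (simp only: split)
  ultimately show ?thesis
    by (simp add: Lim_transform_eventually)
qed

section \<open>Pointwise Fourier inversion\<close>

text \<open>The antiderivative is \<open>cis (y * c)\<close> divided by \<open>\<i> * c\<close>;
  over a symmetric interval the cosine parts cancel and only the sine survives.\<close>

lemma integral_cis_symmetric:
  assumes "0 \<le> A" "c \<noteq> 0"
  shows "(LINT y|lborel. indicator {- A..A} y *\<^sub>R cis (y * c)) = complex_of_real (2 * (sin (A * c) / c))"
proof -
  let ?F = "\<lambda>y. cis (y * c) / (\<i> * complex_of_real c)"
  have "(LBINT y=-A..A. cis (y * c)) = ?F A - ?F (- A)"
  proof (rule interval_integral_FTC_finite)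
    show "continuous_on {min (- A) A..max (- A) A} (\<lambda>y. cis (y * c))"
      by (intro continuous_intros)
    show "(?F has_vector_derivative cis (y * c)) (at y within {min (- A) A..max (- A) A})" for y
      unfolding cis_conv_exp using assms(2)
      by (auto intro!: derivative_eq_intros has_vector_derivative_real_field simp: field_simps)
  qed
  also have "\<dots> = complex_of_real (2 * (sin (A * c) / c))"
    using assms(2) by (simp add: complex_eq_iff Re_divide Im_divide field_simps power2_eq_square)
  finally show ?thesis
    using interval_integral_Icc[of "- A" A "\<lambda>y. cis (y * c)"] assms(1)
    by (simp add: set_lebesgue_integral_def)
qed

lemma truncated_Fourier_inversion:
  fixes g :: "real \<Rightarrow> complex"
  assumes g: "integrable lborel g" and A: "0 \<le> A"
  shows "(LINT y:{- A..A}|lborel. (LINT s|lborel. cis (- (y * s)) * g s) * cis (y * t))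
    = 2 * (LINT u|lborel. (sin (A * u) / u) *\<^sub>R g (t + u))"
proof -
  have [measurable]: "g \<in> borel_measurable borel"
    using g by auto
  have [measurable]: "cis \<in> borel_measurable borel"
    by (intro borel_measurable_continuous_onI continuous_intros)
  let ?h = "\<lambda>y s. indicator {- A..A} y *\<^sub>R (cis (y * (t - s)) * g s)"
  have "(LINT y:{- A..A}|lborel. (LINT s|lborel. cis (- (y * s)) * g s) * cis (y * t))
      = (LINT y|lborel. LINT s|lborel. ?h y s)"
    unfolding set_lebesgue_integral_def
  proof (intro Bochner_Integration.integral_cong refl)
    fix y
    have "(LINT s|lborel. ?h y s) = (LINT s|lborel. (indicator {- A..A} y *\<^sub>R cis (y * t)) * (cis (- (y * s)) * g s))"
      by (intro Bochner_Integration.integral_cong) (auto simp: right_diff_distrib cis_mult split: split_indicator)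
    then show "indicator {- A..A} y *\<^sub>R ((LINT s|lborel. cis (- (y * s)) * g s) * cis (y * t)) = (LINT s|lborel. ?h y s)"
      by (cases "y \<in> {- A..A}") (simp_all add: mult.commute[of _ "cis (y * t)"])
  qed
  \<comment> \<open>Fubini applies because \<open>cis\<close> has modulus 1: the double integrand
    has absolute value at most \<open>norm (g s)\<close> on a strip of finite width.\<close>
  also have "\<dots> = (LINT s|lborel. LINT y|lborel. ?h y s)"
  proof (rule lborel_pair.Fubini_integral[symmetric], rule lborel_pair.Fubini_integrable)
    show "(\<lambda>(y, s). ?h y s) \<in> borel_measurable (lborel \<Otimes>\<^sub>M lborel)"
      by measurable
    show "integrable lborel (\<lambda>y. LINT s|lborel. norm (case (y, s) of (y, s) \<Rightarrow> ?h y s))"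
      using A by (simp add: norm_mult)
    show "AE y in lborel. integrable lborel (\<lambda>s. case (y, s) of (y, s) \<Rightarrow> ?h y s)"
    proof (rule AE_I2)
      fix y
      show "integrable lborel (\<lambda>s. case (y, s) of (y, s) \<Rightarrow> ?h y s)"
        by (rule Bochner_Integration.integrable_bound[OF g]) (auto simp: norm_mult split: split_indicator)
    qed
  qed
  \<comment> \<open>Equality is only almost everywhere: at \<open>s = t\<close> the inner integral
    is \<open>2 * A * g t\<close>, whereas the quotient on the right is 0 by convention.\<close>
  also have "\<dots> = (LINT s|lborel. 2 * ((sin (A * (s - t)) / (s - t)) *\<^sub>R g s))"
  proof (rule integral_cong_AE)
    show "AE s in lborel. (LINT y|lborel. ?h y s) = 2 * ((sin (A * (s - t)) / (s - t)) *\<^sub>R g s)"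
      using AE_lborel_singleton[of t]
    proof eventually_elim
      case (elim s)
      have "(LINT y|lborel. ?h y s) = (LINT y|lborel. (indicator {- A..A} y *\<^sub>R cis (y * (t - s))) * g s)"
        by simp
      also have "\<dots> = complex_of_real (2 * (sin (A * (t - s)) / (t - s))) * g s"
        using elim by (simp only: integral_mult_left_zero integral_cis_symmetric[OF A] right_minus_eq not_sym)
      also have "sin (A * (t - s)) / (t - s) = sin (A * (s - t)) / (s - t)"
        using minus_divide_divide[of "sin (A * (s - t))" "s - t"]
        by (simp only: sin_minus[symmetric] mult_minus_right[symmetric] minus_diff_eq)
      finally show ?case
        by (simp add: scaleR_conv_of_real)
    qed
  qed measurable
  also have "\<dots> = 2 * (LINT s|lborel. (sin (A * (s - t)) / (s - t)) *\<^sub>R g s)"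
    by (rule integral_mult_right_zero)
  also have "(LINT s|lborel. (sin (A * (s - t)) / (s - t)) *\<^sub>R g s) = (LINT u|lborel. (sin (A * u) / u) *\<^sub>R g (t + u))"
    by (subst lborel_integral_real_affine[where c = 1 and t = t]) auto
  finally show ?thesis .
qed

text \<open>The factor 2 of the kernel meets \<open>pi / 2\<close> from the sine integral, so the
  limit is stated before normalisation. Phrasing the regularity as one-sided Lipschitz bounds lets
  jumps of the function and the kink of the weight at 0 be treated alike.\<close>

theorem Fourier_inversion_Dini:
  fixes g :: "real \<Rightarrow> complex"
  assumes "integrable lborel g"
    and "\<forall>\<^sub>F s in at_right t. norm (g s - R) \<le> M * \<bar>s - t\<bar>"
    and "\<forall>\<^sub>F s in at_left t. norm (g s - L) \<le> N * \<bar>s - t\<bar>"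
  shows "((\<lambda>A. LINT y:{- A..A}|lborel. (LINT s|lborel. cis (- (y * s)) * g s) * cis (y * t))
    \<longlongrightarrow> complex_of_real pi * (R + L)) at_top"
proof (rule Lim_transform_eventually)
  show "((\<lambda>A. 2 * (LINT u|lborel. (sin (A * u) / u) *\<^sub>R g (t + u))) \<longlongrightarrow> complex_of_real pi * (R + L)) at_top"
    using tendsto_mult_left[OF Dini_sin_kernel[OF assms], of 2] by (simp add: scaleR_conv_of_real)
  show "\<forall>\<^sub>F A in at_top. 2 * (LINT u|lborel. (sin (A * u) / u) *\<^sub>R g (t + u))
      = (LINT y:{- A..A}|lborel. (LINT s|lborel. cis (- (y * s)) * g s) * cis (y * t))"
    using eventually_ge_at_top[of 0]
    by eventually_elim (simp only: truncated_Fourier_inversion[OF assms(1)])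
qed

section \<open>One-sided Lipschitz bounds for piecewise smooth functions and for the weight\<close>

text \<open>The derivative has a limit, hence is bounded near \<open>a\<close>, and the mean value
  inequality applies between two points to the right of \<open>a\<close>. Since \<open>f a\<close>
  may differ from \<open>L\<close>, the lower point then tends to \<open>a\<close>.\<close>

lemma one_sided_Lipschitz:
  fixes f :: "real \<Rightarrow> 'a::real_normed_vector"
  assumes deriv: "\<forall>\<^sub>F s in at_right a. (f has_vector_derivative f' s) (at s)"
    and f': "(f' \<longlongrightarrow> l) (at_right a)" and f: "(f \<longlongrightarrow> L) (at_right a)"
  shows "\<exists>M. \<forall>\<^sub>F s in at_right a. norm (f s - L) \<le> M * \<bar>s - a\<bar>"
proof -
  define M where "M = norm l + 1"
  have "\<forall>\<^sub>F s in at_right a. norm (f' s) < M"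
    using tendsto_norm[OF f'] by (rule order_tendstoD) (simp add: M_def)
  with deriv have "\<forall>\<^sub>F s in at_right a. (f has_vector_derivative f' s) (at s) \<and> norm (f' s) < M"
    by eventually_elim simp
  then obtain b where b: "a < b"
    "\<And>s. a < s \<Longrightarrow> s < b \<Longrightarrow> (f has_vector_derivative f' s) (at s) \<and> norm (f' s) < M"
    by (auto simp: eventually_at_right_field)
  have "norm (f s - L) \<le> M * \<bar>s - a\<bar>" if s: "a < s" "s < b" for s
  proof (rule tendsto_upperbound)
    show "((\<lambda>u. norm (f s - f u)) \<longlongrightarrow> norm (f s - L)) (at_right a)"
      by (intro tendsto_intros f)
    have "norm (f s - f u) \<le> M * \<bar>s - a\<bar>" if u: "a < u" "u < s" for u
    proof -
      have "norm (f s - f u) \<le> M * norm (s - u)"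
      proof (rule differentiable_bound)
        show "convex {a<..<b}" by simp
        show "(f has_derivative (\<lambda>h. h *\<^sub>R f' x)) (at x within {a<..<b})" if "x \<in> {a<..<b}" for x
          using b(2)[of x] that
          by (auto simp: has_vector_derivative_def intro: has_derivative_at_withinI)
        show "onorm (\<lambda>h. h *\<^sub>R f' x) \<le> M" if "x \<in> {a<..<b}" for x
          using b(2)[of x] that by (intro onorm_le) (auto simp: mult.commute[of M] intro!: mult_left_mono)
      qed (use s u in auto)
      also have "\<dots> \<le> M * \<bar>s - a\<bar>"
        using u by (intro mult_left_mono) (auto simp: M_def)
      finally show ?thesis .
    qed
    then show "\<forall>\<^sub>F u in at_right a. norm (f s - f u) \<le> M * \<bar>s - a\<bar>"
      using s by (auto simp: eventually_at_right_field)
  qed simp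
  then show ?thesis
    using b(1) by (auto simp: eventually_at_right_field)
qed

text \<open>From \<open>1 + x \<le> exp x\<close> one gets
  \<open>exp a - exp b \<le> exp a * \<bar>a - b\<bar>\<close>; adding both exponentials covers
  either sign.\<close>

lemma abs_exp_diff_le: "\<bar>exp a - exp b\<bar> \<le> (exp a + exp b) * \<bar>a - b\<bar>" for a b :: real
proof -
  have le: "exp a - exp b \<le> exp a * \<bar>a - b\<bar>" for a b :: real
  proof -
    have "exp a * (1 - exp (b - a)) \<le> exp a * \<bar>a - b\<bar>"
      using exp_ge_add_one_self[of "b - a"] abs_ge_self[of "a - b"]
      by (intro mult_left_mono) (linarith, simp)
    then show ?thesis by (simp add: right_diff_distrib exp_diff)
  qed
  have "0 \<le> exp a * \<bar>a - b\<bar>" "0 \<le> exp b * \<bar>a - b\<bar>" by auto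
  with le[of a b] le[of b a] show ?thesis
    by (simp add: abs_le_iff distrib_right abs_minus_commute add_increasing add_increasing2)
qed

lemma eventually_Lipschitz_mult:
  fixes w f :: "real \<Rightarrow> 'a::real_normed_algebra"
  assumes f: "\<forall>\<^sub>F s in F. norm (f s - L) \<le> M * \<bar>s - t\<bar>"
    and w: "\<forall>\<^sub>F s in F. norm (w s - W) \<le> N * \<bar>s - t\<bar>"
    and lim: "(w \<longlongrightarrow> W) F"
  shows "\<forall>\<^sub>F s in F. norm (w s * f s - W * L) \<le> ((norm W + 1) * M + N * norm L) * \<bar>s - t\<bar>"
proof -
  have "\<forall>\<^sub>F s in F. norm (w s) < norm W + 1"
    using tendsto_norm[OF lim] by (rule order_tendstoD) simp
  with f w show ?thesis
  proof eventually_elim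
    case (elim s)
    \<comment> \<open>With this splitting only \<open>w s\<close> has to be bounded near the point,
      which its limit guarantees with \<open>norm W + 1\<close>.\<close>
    have "norm (w s * f s - W * L) = norm (w s * (f s - L) + (w s - W) * L)"
      by (simp add: algebra_simps)
    also have "\<dots> \<le> norm (w s) * norm (f s - L) + norm (w s - W) * norm L"
      by (intro norm_triangle_mono norm_mult_ineq)
    also have "\<dots> \<le> (norm W + 1) * (M * \<bar>s - t\<bar>) + (N * \<bar>s - t\<bar>) * norm L"
      using elim order_trans[OF norm_ge_zero elim(2)] by (intro add_mono mult_mono) auto
    finally show ?case by (simp add: algebra_simps)
  qed
qed

lemma piecewise_smooth_eventually_differentiable:
  assumes "piecewise_smooth f"
  shows "\<forall>\<^sub>F s in at t. f differentiable (at s)"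
proof -
  obtain S where S: "finite S" "\<And>s. s \<in> {t - 1..t + 1} - S \<Longrightarrow> f differentiable (at s)"
    using assms unfolding piecewise_smooth_def by meson
  \<comment> \<open>The point \<open>t\<close> is kept even if exceptional, so that the set is an
    open neighbourhood of \<open>t\<close> in which at most \<open>t\<close> itself fails.\<close>
  have "open ({t - 1<..<t + 1} - (S - {t}))"
    using S(1) by (intro open_Diff finite_imp_closed) auto
  then have "\<forall>\<^sub>F s in nhds t. s \<in> {t - 1<..<t + 1} - (S - {t})"
    by (rule eventually_nhds_in_open) auto
  then show ?thesis
    unfolding eventually_at_filter by eventually_elim (auto intro: S(2))
qed

lemma piecewise_smooth_right:
  assumes "piecewise_smooth f"
  obtains R M where "(f \<longlongrightarrow> R) (at_right t)" "\<forall>\<^sub>F s in at_right t. norm (f s - R) \<le> M * \<bar>s - t\<bar>"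
proof -
  let ?f' = "\<lambda>s. vector_derivative f (at s)"
  obtain R l where R: "(f \<longlongrightarrow> R) (at_right t)" and l: "(?f' \<longlongrightarrow> l) (at_right t)"
    using assms unfolding piecewise_smooth_def by blast
  have "\<forall>\<^sub>F s in at t. f differentiable (at s)"
    using piecewise_smooth_eventually_differentiable[OF assms] .
  then have "\<forall>\<^sub>F s in at_right t. (f has_vector_derivative ?f' s) (at s)"
    by (auto simp: eventually_at_split vector_derivative_works elim: eventually_mono)
  then show ?thesis
    using one_sided_Lipschitz[OF _ l R] R that by blast
qed

text \<open>Reflection reduces this to the right-hand bound at \<open>- t\<close>: the function
  \<open>f (- s)\<close> has derivative \<open>- f' (- s)\<close> and the same limit
  \<open>L\<close>.\<close>

lemma piecewise_smooth_left:
  assumes "piecewise_smooth f"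
  obtains L M where "(f \<longlongrightarrow> L) (at_left t)" "\<forall>\<^sub>F s in at_left t. norm (f s - L) \<le> M * \<bar>s - t\<bar>"
proof -
  let ?f' = "\<lambda>s. vector_derivative f (at s)"
  obtain L l where L: "(f \<longlongrightarrow> L) (at_left t)" and l: "(?f' \<longlongrightarrow> l) (at_left t)"
    using assms unfolding piecewise_smooth_def by blast
  have "\<forall>\<^sub>F s in at t. f differentiable (at s)"
    using piecewise_smooth_eventually_differentiable[OF assms] .
  then have "\<forall>\<^sub>F s in at_left t. (f has_vector_derivative ?f' s) (at s)"
    by (auto simp: eventually_at_split vector_derivative_works elim: eventually_mono)
  then have "\<forall>\<^sub>F s in at_right (- t). (f has_vector_derivative ?f' (- s)) (at (- s))"
    by (simp add: eventually_at_left_to_right)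
  then have "\<forall>\<^sub>F s in at_right (- t). ((\<lambda>s. f (- s)) has_vector_derivative - ?f' (- s)) (at s)"
  proof eventually_elim
    case (elim s)
    have "(uminus has_vector_derivative - 1) (at s)"
      by (auto intro!: derivative_eq_intros)
    from vector_diff_chain_at[OF this elim] show ?case
      by (simp add: o_def)
  qed
  moreover have "((\<lambda>s. - ?f' (- s)) \<longlongrightarrow> - l) (at_right (- t))"
    using l by (intro tendsto_minus) (simp add: filterlim_at_left_to_right)
  moreover have "((\<lambda>s. f (- s)) \<longlongrightarrow> L) (at_right (- t))"
    using L by (simp add: filterlim_at_left_to_right)
  ultimately obtain M where "\<forall>\<^sub>F s in at_right (- t). norm (f (- s) - L) \<le> M * \<bar>s - (- t)\<bar>"
    using one_sided_Lipschitz[of "\<lambda>s. f (- s)" "\<lambda>s. - ?f' (- s)" "- t" "- l" L] by blast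
  moreover have "\<bar>- s - t\<bar> = \<bar>s - (- t)\<bar>" for s
    by simp
  ultimately have "\<forall>\<^sub>F s in at_left t. norm (f s - L) \<le> M * \<bar>s - t\<bar>"
    unfolding eventually_at_left_to_right by simp
  with L that show ?thesis by blast
qed

text \<open>\<^term>\<open>heaviside t * t = max t 0\<close> and \<^term>\<open>heaviside (- t) * t = min t 0\<close>; in
  particular the weight is continuous at 0.\<close>

lemma weight_Lipschitz:
  fixes x1 x2 :: real
  defines "\<phi> \<equiv> \<lambda>s. (- x1 * heaviside s + x2 * heaviside (- s)) * s"
  shows "((\<lambda>s. exp (\<phi> s)) \<longlongrightarrow> exp (\<phi> t)) (at t)"
    and "\<exists>N. \<forall>\<^sub>F s in at t. \<bar>exp (\<phi> s) - exp (\<phi> t)\<bar> \<le> N * \<bar>s - t\<bar>"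
proof -
  \<comment> \<open>At 0 both Heaviside factors equal 1, but the factor \<open>s\<close> removes
    them.\<close>
  have \<phi>: "\<phi> = (\<lambda>s. - x1 * max s 0 + x2 * min s 0)"
    by (auto simp: \<phi>_def heaviside_def max_def min_def)
  show lim: "((\<lambda>s. exp (\<phi> s)) \<longlongrightarrow> exp (\<phi> t)) (at t)"
    unfolding \<phi> by (intro tendsto_intros)
  have Lip: "\<bar>\<phi> s - \<phi> t\<bar> \<le> (\<bar>x1\<bar> + \<bar>x2\<bar>) * \<bar>s - t\<bar>" for s
  proof -
    have "\<bar>\<phi> s - \<phi> t\<bar> = \<bar>x1 * (max t 0 - max s 0) + x2 * (min s 0 - min t 0)\<bar>"
      by (simp add: \<phi> algebra_simps)
    also have "\<dots> \<le> \<bar>x1\<bar> * \<bar>max t 0 - max s 0\<bar> + \<bar>x2\<bar> * \<bar>min s 0 - min t 0\<bar>"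
      by (rule order_trans[OF abs_triangle_ineq]) (simp add: abs_mult)
    also have "\<dots> \<le> \<bar>x1\<bar> * \<bar>s - t\<bar> + \<bar>x2\<bar> * \<bar>s - t\<bar>"
      by (intro add_mono mult_left_mono) auto
    finally show ?thesis by (simp add: distrib_right)
  qed
  have "\<forall>\<^sub>F s in at t. exp (\<phi> s) < exp (\<phi> t) + 1"
    using lim by (rule order_tendstoD) simp
  \<comment> \<open>Near \<open>t\<close> the sum of the two exponentials is below
    \<open>2 * exp (\<phi> t) + 1\<close>; the other factor is the Lipschitz constant of the
    exponent.\<close>
  then have "\<forall>\<^sub>F s in at t. \<bar>exp (\<phi> s) - exp (\<phi> t)\<bar> \<le> ((2 * exp (\<phi> t) + 1) * (\<bar>x1\<bar> + \<bar>x2\<bar>)) * \<bar>s - t\<bar>"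
  proof eventually_elim
    case (elim s)
    have "\<bar>exp (\<phi> s) - exp (\<phi> t)\<bar> \<le> (exp (\<phi> s) + exp (\<phi> t)) * \<bar>\<phi> s - \<phi> t\<bar>"
      by (rule abs_exp_diff_le)
    also have "\<dots> \<le> (2 * exp (\<phi> t) + 1) * ((\<bar>x1\<bar> + \<bar>x2\<bar>) * \<bar>s - t\<bar>)"
      using elim Lip by (intro mult_mono) (auto intro: add_nonneg_nonneg)
    finally show ?case by (simp only: mult.assoc)
  qed
  then show "\<exists>N. \<forall>\<^sub>F s in at t. \<bar>exp (\<phi> s) - exp (\<phi> t)\<bar> \<le> N * \<bar>s - t\<bar>" ..
qed

section \<open>Inversion of the symmetric Laplace transform\<close>

theorem theorem2:
  fixes f :: "real \<Rightarrow> complex" and U :: "(real \<times> real) set"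
  assumes "piecewise_smooth f"
    and "\<And>x1 x2. (x1, x2) \<in> U \<Longrightarrow>
           integrable lborel
             (\<lambda>t. complex_of_real (exp ((- x1 * heaviside t + x2 * heaviside (- t)) * t)) * f t)"
  shows "\<forall>(x1, x2)\<in>U. \<forall>t::real.
           ((\<lambda>A::real. 1 / (2 * complex_of_real pi) *
               (LINT y:{-A..A}|lborel. symmetric_laplace f x1 x2 y *
                  exp ((complex_of_real (x1 * heaviside t - x2 * heaviside (- t))
                         + \<i> * complex_of_real y) * complex_of_real t)))
             \<longlongrightarrow> 1 / 2 * (Lim (at_right t) f + Lim (at_left t) f)) at_top"
proof (clarify)
  fix x1 x2 t :: real
  assume "(x1, x2) \<in> U"
  define \<phi> where "\<phi> s = (- x1 * heaviside s + x2 * heaviside (- s)) * s" for s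
  define w where "w s = complex_of_real (exp (\<phi> s))" for s
  have int: "integrable lborel (\<lambda>s. w s * f s)"
    using assms(2)[OF \<open>(x1, x2) \<in> U\<close>] by (simp add: w_def \<phi>_def)
  have wt: "w t \<noteq> 0" by (simp add: w_def)
  obtain R M where R: "(f \<longlongrightarrow> R) (at_right t)" "\<forall>\<^sub>F s in at_right t. norm (f s - R) \<le> M * \<bar>s - t\<bar>"
    using piecewise_smooth_right[OF assms(1)] .
  obtain L K where L: "(f \<longlongrightarrow> L) (at_left t)" "\<forall>\<^sub>F s in at_left t. norm (f s - L) \<le> K * \<bar>s - t\<bar>"
    using piecewise_smooth_left[OF assms(1)] .
  \<comment> \<open>\<open>Lim\<close> is a definite description, so it has to be identified through
    the limits just obtained.\<close>
  have Lims: "Lim (at_right t) f = R" "Lim (at_left t) f = L"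
    using R(1) L(1) by (auto intro!: tendsto_Lim)
  obtain N where "\<forall>\<^sub>F s in at t. \<bar>exp (\<phi> s) - exp (\<phi> t)\<bar> \<le> N * \<bar>s - t\<bar>"
    using weight_Lipschitz(2)[of x1 x2 t] unfolding \<phi>_def by blast
  then have "\<forall>\<^sub>F s in at t. norm (w s - w t) \<le> N * \<bar>s - t\<bar>"
    by (simp add: w_def of_real_diff[symmetric] del: of_real_diff)
  then have w: "\<forall>\<^sub>F s in at_right t. norm (w s - w t) \<le> N * \<bar>s - t\<bar>"
    "\<forall>\<^sub>F s in at_left t. norm (w s - w t) \<le> N * \<bar>s - t\<bar>"
    by (simp_all add: eventually_at_split)
  have "(w \<longlongrightarrow> w t) (at t)"
    unfolding w_def \<phi>_def by (intro tendsto_of_real weight_Lipschitz(1))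
  then have wlim: "(w \<longlongrightarrow> w t) (at_right t)" "(w \<longlongrightarrow> w t) (at_left t)"
    by (simp_all add: filterlim_at_split)
  let ?I = "\<lambda>A. LINT y:{-A..A}|lborel. (LINT s|lborel. cis (- (y * s)) * (w s * f s)) * cis (y * t)"
  \<comment> \<open>The weight is continuous at \<open>t\<close>, so the one-sided limits of
    \<open>w s * f s\<close> are those of \<open>f\<close> times \<open>w t\<close>.\<close>
  have "(?I \<longlongrightarrow> complex_of_real pi * (w t * R + w t * L)) at_top"
    by (rule Fourier_inversion_Dini[OF int eventually_Lipschitz_mult[OF R(2) w(1) wlim(1)]
          eventually_Lipschitz_mult[OF L(2) w(2) wlim(2)]])
  then have lim: "((\<lambda>A. 1 / (2 * complex_of_real pi) * (?I A / w t))
      \<longlongrightarrow> 1 / (2 * complex_of_real pi) * (complex_of_real pi * (w t * R + w t * L) / w t)) at_top"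
    by (intro tendsto_intros wt)
  have limit: "1 / (2 * complex_of_real pi) * (complex_of_real pi * (w t * R + w t * L) / w t) = 1 / 2 * (R + L)"
    using wt by (simp add: field_simps)
  \<comment> \<open>The forward exponential is \<open>cis (- (y * s))\<close> times the weight at
    \<open>s\<close>; the inverse one is \<open>cis (y * t)\<close> divided by the weight at
    \<open>t\<close>. The latter does not depend on \<open>y\<close> and leaves the
    integral.\<close>
  have integrand: "symmetric_laplace f x1 x2 y * exp ((complex_of_real (x1 * heaviside t - x2 * heaviside (- t))
        + \<i> * complex_of_real y) * complex_of_real t)
      = (LINT s|lborel. cis (- (y * s)) * (w s * f s)) * cis (y * t) / w t" for y
  proof -
    have "exp ((complex_of_real (- x1 * heaviside s + x2 * heaviside (- s)) - \<i> * complex_of_real y) * complex_of_real s)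
        = cis (- (y * s)) * w s" for s
      unfolding w_def \<phi>_def cis_conv_exp exp_of_real[symmetric] exp_add[symmetric]
      by (simp add: algebra_simps)
    moreover have "exp ((complex_of_real (x1 * heaviside t - x2 * heaviside (- t)) + \<i> * complex_of_real y) * complex_of_real t)
        = cis (y * t) / w t"
      unfolding w_def \<phi>_def cis_conv_exp exp_of_real[symmetric] exp_diff[symmetric]
      by (simp add: algebra_simps)
    ultimately show ?thesis
      by (simp add: symmetric_laplace_def mult.assoc)
  qed
  show "((\<lambda>A::real. 1 / (2 * complex_of_real pi) *
               (LINT y:{-A..A}|lborel. symmetric_laplace f x1 x2 y *
                  exp ((complex_of_real (x1 * heaviside t - x2 * heaviside (- t))
                         + \<i> * complex_of_real y) * complex_of_real t)))
             \<longlongrightarrow> 1 / 2 * (Lim (at_right t) f + Lim (at_left t) f)) at_top"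
    using lim by (simp only: Lims limit integrand set_integral_divide_zero)
qed

end
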